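(* Let $n,k\ge 2$, and let $G$ be a $k$-uniform hypergraph with vertex set $[n]$. Let $E\subseteq E(G)$. Let $\mathbf{x}$ and $\mathbf{y}$ be the unit eigenvectors of $\rho(G)$ and $\rho(G-E)$, respectively. Then $$\rho(G)-k\sum_{e\in E}\mathbf{x}^e\ \le\ \rho(G-E)\ \le\ \rho(G)-k\sum_{e\in E}\mathbf{y}^e.$$
   Context: $[n]=\{1,\dots,n\}$. A $k$-uniform hypergraph $G$ has vertex set $V(G)$ and edge set $E(G)$ consisting of $k$-element subsets of $V(G)$. Its adjacency tensor $\mathcal{A}(G)=(a_{i_1\dots i_k})$ has order $k$ and dimension $|V(G)|$, with $a_{i_1\dots i_k}=\frac{1}{(k-1)!}$ if $\{i_1,\dots,i_k\}\in E(G)$ and $0$ otherwise. For a vector $\mathbf{x}$ indexed by $V(G)$ and $U\subseteq V(G)$, $\mathbf{x}^U=\prod_{w\in U}x_w$. A nonzero vector $\mathbf{x}$ is an eigenvector of $\mathcal{A}(G)$ for the eigenvalue $\lambda$ if $\lambda x_u^{k-1}=\sum_{e\in E(G),\,u\in e}\mathbf{x}^{e\setminus\{u\}}$ for all $u\in V(G)$. The spectral radius $\rho(G)$ is the largest modulus of the (complex) eigenvalues of $\mathcal{A}(G)$; it equals the largest H-eigenvalue (real eigenvalue with a real eigenvector) of $\mathcal{A}(G)$. An eigenvector of $\rho(G)$ means an eigenvector of $\mathcal{A}(G)$ corresponding to $\rho(G)$, and likewise for $G-E$. A vector $\mathbf{x}\in\mathbb{R}^n$ is unit if $\sum_{i\in[n]}|x_i|^k=1$.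 $G-E$ is the hypergraph with vertex set $V(G)$ and edge set $E(G)\setminus E$.
   Formalization: For odd k the eigenvector x of ρ(G) is additionally assumed nonnegative; otherwise the lower bound fails, e.g. k = n = 3, E(G) = E = {{1,2,3}}, x = −3^(−1/3)(1,1,1) would give 2 ≤ 0. Nothing is added for even k, or for y. *)

theory Defs
  imports Complex_Main
begin

datatype 'v hypergraph = Hypergraph (verts: "'v set") (edges: "'v set set")

definition uniform_hypergraph :: "nat \<Rightarrow> 'v hypergraph \<Rightarrow> bool" where
  "uniform_hypergraph k G \<longleftrightarrow>
     finite (verts G) \<and> (\<forall>e \<in> edges G. e \<subseteq> verts G \<and> card e = k)"

definition delete_edges :: "'v hypergraph \<Rightarrow> 'v set set \<Rightarrow> 'v hypergraph" where
  "delete_edges G E = Hypergraph (verts G) (edges G - E)"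

text \<open>Vectors indexed by the vertices are functions of which only the values on
  \<^term>\<open>verts G\<close> matter. The scalars are real or complex.\<close>

definition eigenvector_of ::
  "nat \<Rightarrow> 'v hypergraph \<Rightarrow> ('v \<Rightarrow> 'a::field) \<Rightarrow> 'a \<Rightarrow> bool" where
  "eigenvector_of k G x l \<longleftrightarrow>
     (\<exists>u \<in> verts G. x u \<noteq> 0) \<and>
     (\<forall>u \<in> verts G. l * x u ^ (k - 1) =
        (\<Sum>e | e \<in> edges G \<and> u \<in> e. \<Prod>w \<in> e - {u}. x w))"

text \<open>The equation above is the eigenvalue equation of the adjacency tensor, whose entries
  are indexed here by lists of \<open>k\<close> vertices: see \<open>adjacency_tensor_apply\<close> below.\<close>

definition adjacency_tensor :: "nat \<Rightarrow> 'v hypergraph \<Rightarrow> 'v list \<Rightarrow> 'a::field_char_0" where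
  "adjacency_tensor k G is = (if set is \<in> edges G then 1 / fact (k - 1) else 0)"

lemma adjacency_tensor_apply:
  fixes x :: "'v \<Rightarrow> 'a::field_char_0"
  assumes G: "uniform_hypergraph k G" and u: "u \<in> verts G" and k: "k \<ge> 1"
  shows "(\<Sum>is | set is \<subseteq> verts G \<and> length is = k - 1.
            adjacency_tensor k G (u # is) * (\<Prod>i\<leftarrow>is. x i)) =
         (\<Sum>e | e \<in> edges G \<and> u \<in> e. \<Prod>w \<in> e - {u}. x w)"
proof -
  let ?L = "{is. set is \<subseteq> verts G \<and> length is = k - 1}"
  let ?D = "{e. e \<in> edges G \<and> u \<in> e}"
  let ?P = "\<lambda>e. {is. length is = k - 1 \<and> distinct is \<and> set is \<subseteq> e - {u}}"
  have finV: "finite (verts G)" using G by (simp add: uniform_hypergraph_def)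
  have finL: "finite ?L" using finite_lists_length_eq[OF finV] by simp
  have finD: "finite ?D"
    by (rule finite_subset[of _ "Pow (verts G)"])
       (use G finV in \<open>auto simp: uniform_hypergraph_def\<close>)
  have e: "finite e" "card (e - {u}) = k - 1" "e \<subseteq> verts G" if "e \<in> ?D" for e
    using that G finV by (auto simp: uniform_hypergraph_def intro: finite_subset)
  have fib: "{is \<in> ?L. insert u (set is) = e} = ?P e" if eD: "e \<in> ?D" for e
  proof (intro equalityI subsetI)
    fix l assume l: "l \<in> {is \<in> ?L. insert u (set is) = e}"
    have "e - {u} \<subseteq> set l" using l by auto
    moreover have "card (set l) \<le> card (e - {u})" using l e(2)[OF eD] card_length[of l] by simp
    ultimately have "set l = e - {u}" by (metis List.finite_set card_seteq)
    then show "l \<in> ?P e" using l e(2)[OF eD] by (auto intro: card_distinct)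
  next
    fix l assume l: "l \<in> ?P e"
    then have "card (set l) = card (e - {u})" using e(2)[OF eD] by (simp add: distinct_card)
    then have "set l = e - {u}" using l e(1)[OF eD] by (intro card_subset_eq) auto
    then show "l \<in> {is \<in> ?L. insert u (set is) = e}" using l eD e(3)[OF eD] by auto
  qed
  have inner: "(\<Sum>is \<in> ?P e. 1 / fact (k - 1) * (\<Prod>i\<leftarrow>is. x i)) = (\<Prod>w \<in> e - {u}. x w)"
    if eD: "e \<in> ?D" for e
  proof -
    have fin: "finite (e - {u})" using e(1)[OF eD] by simp
    have "card (?P e) = \<Prod>{1..k - 1}"
      using card_lists_distinct_length_eq[OF fin, of "k - 1"] e(2)[OF eD] by simp
    then have c: "card (?P e) = fact (k - 1)" by (simp add: fact_prod)
    have "(\<Prod>i\<leftarrow>l. x i) = (\<Prod>w \<in> e - {u}. x w)" if l: "l \<in> ?P e" for l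
    proof -
      have "set l = e - {u}" using l fin e(2)[OF eD]
        by (intro card_subset_eq) (auto simp: distinct_card)
      then show ?thesis using l by (metis (mono_tags, lifting) mem_Collect_eq prod.distinct_set_conv_list)
    qed
    then have "(\<Sum>is \<in> ?P e. 1 / fact (k - 1) * (\<Prod>i\<leftarrow>is. x i)) =
      (\<Sum>is \<in> ?P e. 1 / fact (k - 1) * (\<Prod>w \<in> e - {u}. x w))" by (intro sum.cong) auto
    also have "\<dots> = (\<Prod>w \<in> e - {u}. x w)" using c by simp
    finally show ?thesis .
  qed
  have "(\<Sum>is\<in>?L. adjacency_tensor k G (u # is) * (\<Prod>i\<leftarrow>is. x i)) =
        (\<Sum>is \<in> {is \<in> ?L. insert u (set is) \<in> ?D}. 1 / fact (k - 1) * (\<Prod>i\<leftarrow>is. x i))"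
    using finL by (intro sum.mono_neutral_cong_right) (auto simp: adjacency_tensor_def)
  also have "\<dots> = (\<Sum>e\<in>?D. \<Sum>is | is \<in> {is \<in> ?L. insert u (set is) \<in> ?D} \<and> insert u (set is) = e.
                 1 / fact (k - 1) * (\<Prod>i\<leftarrow>is. x i))"
    by (intro sum.group[symmetric] finD finite_subset[OF _ finL]) auto
  also have "\<dots> = (\<Sum>e\<in>?D. \<Sum>is \<in> ?P e. 1 / fact (k - 1) * (\<Prod>i\<leftarrow>is. x i))"
  proof (intro sum.cong refl)
    fix e assume eD: "e \<in> ?D"
    then have "{is. is \<in> {is \<in> ?L. insert u (set is) \<in> ?D} \<and> insert u (set is) = e} =
        {is \<in> ?L. insert u (set is) = e}" by blast
    then show "{is. is \<in> {is \<in> ?L. insert u (set is) \<in> ?D} \<and> insert u (set is) = e} = ?P e"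
      using fib[OF eD] by (rule trans)
  qed
  also have "\<dots> = (\<Sum>e\<in>?D. \<Prod>w \<in> e - {u}. x w)"
    by (intro sum.cong refl inner)
  finally show ?thesis .
qed

text \<open>For a uniform hypergraph with at least one vertex and \<open>k \<ge> 2\<close> this supremum is a
  maximum: it is the largest modulus of a complex eigenvalue.\<close>

definition spectral_radius_of :: "nat \<Rightarrow> 'v hypergraph \<Rightarrow> real" where
  "spectral_radius_of k G =
     Sup {cmod l | l. \<exists>x :: 'v \<Rightarrow> complex. eigenvector_of k G x l}"

text \<open>For odd \<open>k\<close> the negative of a real eigenvector belongs to the same eigenvalue and has
  the same norm, but its products over edges have the opposite sign. Being a unit eigenvector
  therefore does not determine these products, and sign conditions have to be stated apart.\<close>

definition unit_on :: "nat \<Rightarrow> 'v set \<Rightarrow> ('v \<Rightarrow> real) \<Rightarrow> bool" where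
  "unit_on k V x \<longleftrightarrow> (\<Sum>i \<in> V. \<bar>x i\<bar> ^ k) = 1"

end

theory Submission
  imports Defs "HOL-Analysis.Function_Topology"
begin

text \<open>
  The spectral radius has a variational description: \<open>\<rho>(G)\<close> is the maximum of the form
  \<open>k \<Sum>\<^sub>e z\<^sup>e\<close> over the nonnegative vectors \<open>z\<close> with \<open>\<Sum>\<^sub>u z\<^sub>u\<^sup>k = 1\<close>
  (\<open>adjacency_form_le_spectral_radius\<close>). Deleting the edges of \<open>E\<close> lowers the form by exactly
  \<open>k \<Sum>\<^bsub>e\<in>E\<^esub> z\<^sup>e\<close>, and both inequalities arise by using an eigenvector of one hypergraph as a trial
  vector for the other.

  One half of the description holds for every eigenvector, real or complex. If the eigenvalue
  equation at \<open>u\<close> is multiplied by \<open>x\<^sub>u\<close> and the results are added, each edge is counted \<open>k\<close>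
  times; with moduli and the triangle inequality this bounds \<open>|\<lambda>| \<Sum>\<^sub>u |x\<^sub>u|\<^sup>k\<close> by the form at
  \<open>|x|\<close> (\<open>eigenvalue_le_adjacency_form\<close>).

  For the other half, a maximiser exists by compactness, and it is an eigenvector for the maximum
  (\<open>maximiser_is_eigenvector\<close>). The form is affine in each single coordinate, so changing one
  coordinate at a time gives the eigenvalue equation there; this includes coordinates at the
  boundary value \<open>0\<close>, because \<open>k \<ge> 2\<close>.

  For the lower bound \<open>x\<close> must satisfy \<open>\<Sum>\<^sub>u x\<^sub>u\<^sup>k = 1\<close>, so that \<open>\<rho>(G)\<close> equals the form at \<open>x\<close>; for
  odd \<open>k\<close> this is where the sign of \<open>x\<close> enters. The upper bound has to hold for \<open>y\<close> of mixed signs,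
  where \<open>\<rho>(G - E)\<close> may differ from the form at \<open>y\<close>. It combines the estimate of \<open>\<rho>(G - E)\<close> by the
  form of \<open>G - E\<close> at \<open>|y|\<close> with \<open>y\<^sup>e \<le> |y|\<^sup>e\<close> for \<open>e \<in> E\<close>.
\<close>

section \<open>The form of the adjacency tensor\<close>

definition adjacency_form :: "nat \<Rightarrow> 'v hypergraph \<Rightarrow> ('v \<Rightarrow> real) \<Rightarrow> real" where
  "adjacency_form k G z = real k * (\<Sum>e \<in> edges G. \<Prod>w \<in> e. z w)"

lemma uniform_hypergraph_finite:
  assumes "uniform_hypergraph k G"
  shows "finite (verts G)" "finite (edges G)"
    "e \<in> edges G \<Longrightarrow> finite e" "e \<in> edges G \<Longrightarrow> e \<subseteq> verts G" "e \<in> edges G \<Longrightarrow> card e = k"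
proof -
  show V: "finite (verts G)" using assms by (simp add: uniform_hypergraph_def)
  have "edges G \<subseteq> Pow (verts G)" using assms by (auto simp: uniform_hypergraph_def)
  then show "finite (edges G)" using V by (meson finite_Pow_iff finite_subset)
  show "e \<in> edges G \<Longrightarrow> finite e" "e \<in> edges G \<Longrightarrow> e \<subseteq> verts G" "e \<in> edges G \<Longrightarrow> card e = k"
    using assms V by (auto simp: uniform_hypergraph_def intro: finite_subset)
qed

text \<open>Double counting of the incident pairs \<open>u \<in> e\<close>: the edge \<open>e\<close> contributes \<open>x\<^sup>e\<close> once for each of
  its \<open>k\<close> vertices.\<close>

lemma adjacency_form_handshake:
  fixes x :: "'v \<Rightarrow> real"
  assumes G: "uniform_hypergraph k G"
  shows "(\<Sum>u \<in> verts G. x u * (\<Sum>e | e \<in> edges G \<and> u \<in> e. \<Prod>w \<in> e - {u}. x w)) = adjacency_form k G x"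
proof -
  note fin = uniform_hypergraph_finite[OF G]
  have "(\<Sum>u \<in> verts G. x u * (\<Sum>e | e \<in> edges G \<and> u \<in> e. \<Prod>w \<in> e - {u}. x w)) =
        (\<Sum>u \<in> verts G. \<Sum>e | e \<in> edges G \<and> u \<in> e. \<Prod>w \<in> e. x w)"
    unfolding sum_distrib_left by (intro sum.cong refl) (auto simp: prod.remove fin)
  also have "\<dots> = (\<Sum>e \<in> edges G. \<Sum>u | u \<in> verts G \<and> u \<in> e. \<Prod>w \<in> e. x w)"
    by (rule sum.swap_restrict) (use fin in auto)
  also have "\<dots> = (\<Sum>e \<in> edges G. real k * (\<Prod>w \<in> e. x w))"
  proof (intro sum.cong refl)
    fix e assume e: "e \<in> edges G"
    then have "{u. u \<in> verts G \<and> u \<in> e} = e" using fin(4) by blast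
    then show "(\<Sum>u | u \<in> verts G \<and> u \<in> e. \<Prod>w \<in> e. x w) = real k * (\<Prod>w \<in> e. x w)"
      using fin(5)[OF e] by simp
  qed
  finally show ?thesis by (simp add: adjacency_form_def sum_distrib_left)
qed

lemma adjacency_form_affine_in_coordinate:
  assumes G: "uniform_hypergraph k G"
  shows "adjacency_form k G (z(u := t)) =
    adjacency_form k G z + real k * ((t - z u) * (\<Sum>e | e \<in> edges G \<and> u \<in> e. \<Prod>w \<in> e - {u}. z w))"
proof -
  note fin = uniform_hypergraph_finite[OF G]
  have edge: "(\<Prod>w \<in> e. (z(u := t)) w) =
      (\<Prod>w \<in> e. z w) + (if u \<in> e then (t - z u) * (\<Prod>w \<in> e - {u}. z w) else 0)"
    if "e \<in> edges G" for e
  proof (cases "u \<in> e")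
    case True
    have "(\<Prod>w \<in> e - {u}. (z(u := t)) w) = (\<Prod>w \<in> e - {u}. z w)" by (rule prod.cong) auto
    then show ?thesis
      using True prod.remove[OF fin(3)[OF that] True, of "z(u := t)"]
        prod.remove[OF fin(3)[OF that] True, of z] by (simp add: algebra_simps)
  next
    case False
    then have "(\<Prod>w \<in> e. (z(u := t)) w) = (\<Prod>w \<in> e. z w)" by (intro prod.cong) auto
    then show ?thesis using False by simp
  qed
  have "(\<Sum>e \<in> edges G. \<Prod>w \<in> e. (z(u := t)) w) = (\<Sum>e \<in> edges G. \<Prod>w \<in> e. z w) +
      (\<Sum>e \<in> edges G. if u \<in> e then (t - z u) * (\<Prod>w \<in> e - {u}. z w) else 0)"
    unfolding sum.distrib[symmetric] by (intro sum.cong refl edge)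
  also have "(\<Sum>e \<in> edges G. if u \<in> e then (t - z u) * (\<Prod>w \<in> e - {u}. z w) else 0) =
      (t - z u) * (\<Sum>e | e \<in> edges G \<and> u \<in> e. \<Prod>w \<in> e - {u}. z w)"
    using fin(2) by (simp add: sum.inter_filter sum_distrib_left if_distrib cong: if_cong)
  finally show ?thesis
    unfolding adjacency_form_def by (simp only: distrib_left)
qed

lemma adjacency_form_scale:
  assumes G: "uniform_hypergraph k G"
  shows "adjacency_form k G (\<lambda>u. c * z u) = c ^ k * adjacency_form k G z"
proof -
  have "(\<Sum>e \<in> edges G. \<Prod>w \<in> e. c * z w) = (\<Sum>e \<in> edges G. c ^ k * (\<Prod>w \<in> e. z w))"
    by (intro sum.cong refl) (simp add: prod.distrib uniform_hypergraph_finite(5)[OF G])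
  then show ?thesis by (simp add: adjacency_form_def sum_distrib_left mult_ac)
qed

lemma adjacency_form_cong:
  assumes G: "uniform_hypergraph k G" and "\<And>u. u \<in> verts G \<Longrightarrow> y u = z u"
  shows "adjacency_form k G y = adjacency_form k G z"
proof -
  have "(\<Sum>e \<in> edges G. \<Prod>w \<in> e. y w) = (\<Sum>e \<in> edges G. \<Prod>w \<in> e. z w)"
    using uniform_hypergraph_finite(4)[OF G] assms(2) by (intro sum.cong prod.cong) auto
  then show ?thesis by (simp add: adjacency_form_def)
qed

lemma adjacency_form_le_abs: "adjacency_form k G z \<le> adjacency_form k G (\<lambda>u. \<bar>z u\<bar>)"
  unfolding adjacency_form_def
  by (intro mult_left_mono sum_mono) (auto simp flip: abs_prod)

lemma adjacency_form_delete_edges: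
  assumes G: "uniform_hypergraph k G" and E: "E \<subseteq> edges G"
  shows "adjacency_form k (delete_edges G E) z =
    adjacency_form k G z - real k * (\<Sum>e \<in> E. \<Prod>w \<in> e. z w)"
  using sum_diff[OF uniform_hypergraph_finite(2)[OF G] E, of "\<lambda>e. \<Prod>w \<in> e. z w"]
  by (simp add: adjacency_form_def delete_edges_def right_diff_distrib)

lemma uniform_hypergraph_delete_edges:
  "uniform_hypergraph k G \<Longrightarrow> uniform_hypergraph k (delete_edges G E)"
  by (auto simp: uniform_hypergraph_def delete_edges_def)

text \<open>Stated for any normed field so that it applies to the complex eigenvectors in the
  definition of the spectral radius and also to real eigenvectors of arbitrary sign.\<close>

lemma eigenvalue_le_adjacency_form:
  fixes x :: "'v \<Rightarrow> 'a::real_normed_field"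
  assumes G: "uniform_hypergraph k G" and k: "k \<ge> 1" and x: "eigenvector_of k G x l"
  shows "norm l * (\<Sum>u \<in> verts G. norm (x u) ^ k) \<le> adjacency_form k G (\<lambda>u. norm (x u))"
proof -
  have "norm l * norm (x u) ^ k \<le>
      norm (x u) * (\<Sum>e | e \<in> edges G \<and> u \<in> e. \<Prod>w \<in> e - {u}. norm (x w))"
    if u: "u \<in> verts G" for u
  proof -
    have "norm l * norm (x u) ^ (k - 1) = norm (\<Sum>e | e \<in> edges G \<and> u \<in> e. \<Prod>w \<in> e - {u}. x w)"
      using x u unfolding eigenvector_of_def by (metis norm_mult norm_power)
    also have "\<dots> \<le> (\<Sum>e | e \<in> edges G \<and> u \<in> e. \<Prod>w \<in> e - {u}. norm (x w))"
      by (rule order_trans[OF norm_sum]) (simp add: prod_norm)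
    finally have "norm (x u) * (norm l * norm (x u) ^ (k - 1)) \<le>
        norm (x u) * (\<Sum>e | e \<in> edges G \<and> u \<in> e. \<Prod>w \<in> e - {u}. norm (x w))"
      by (rule mult_left_mono) simp
    moreover have "norm (x u) ^ k = norm (x u) * norm (x u) ^ (k - 1)"
      using k by (simp add: power_eq_if)
    ultimately show ?thesis by (simp add: mult_ac)
  qed
  then have "(\<Sum>u \<in> verts G. norm l * norm (x u) ^ k) \<le> adjacency_form k G (\<lambda>u. norm (x u))"
    unfolding adjacency_form_handshake[OF G, symmetric] by (rule sum_mono)
  then show ?thesis by (simp add: sum_distrib_left)
qed

section \<open>The spectral radius as a maximum\<close>

text \<open>Vectors are functions on the whole vertex type, and the topology on them is the product
  topology. Pinning the coordinates outside \<open>verts G\<close> to \<open>0\<close> makes the unit sphere compact. The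
  bound is given in its homogeneous form, which spares later uses from normalising.\<close>

lemma adjacency_form_maximiser_exists:
  assumes G: "uniform_hypergraph k G" and k: "k \<ge> 1" and ne: "verts G \<noteq> {}"
  obtains z where "\<And>u. z u \<ge> 0" "(\<Sum>u \<in> verts G. z u ^ k) = 1"
    "\<And>y. (\<And>u. u \<in> verts G \<Longrightarrow> y u \<ge> 0) \<Longrightarrow>
       adjacency_form k G y \<le> adjacency_form k G z * (\<Sum>u \<in> verts G. y u ^ k)"
proof -
  note fin = uniform_hypergraph_finite[OF G]
  define B :: "('a \<Rightarrow> real) set" where
    "B = (\<Pi>\<^sub>E u\<in>UNIV. if u \<in> verts G then {0..1} else {0})"
  define S where "S = B \<inter> {z. (\<Sum>u \<in> verts G. z u ^ k) = 1}"
  have mem_S: "z \<in> S \<longleftrightarrow> (\<forall>u \<in> verts G. 0 \<le> z u \<and> z u \<le> 1) \<and> (\<forall>u. u \<notin> verts G \<longrightarrow> z u = 0) \<and>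
      (\<Sum>u \<in> verts G. z u ^ k) = 1" for z
    unfolding S_def B_def PiE_def Pi_def by (auto split: if_splits)
  have "compactin (product_topology (\<lambda>_. euclidean) UNIV) B"
    unfolding B_def by (subst compactin_PiE) auto
  then have "compact B" by (simp add: euclidean_product_topology)
  moreover have "closed {z :: 'a \<Rightarrow> real. (\<Sum>u \<in> verts G. z u ^ k) = 1}"
    by (intro closed_Collect_eq continuous_intros continuous_on_product_coordinates)
  ultimately have "compact S" unfolding S_def by blast
  moreover have "S \<noteq> {}"
  proof -
    obtain v where v: "v \<in> verts G" using ne by blast
    have "(\<Sum>u \<in> verts G. (if u = v then 1 else 0 :: real) ^ k) = (\<Sum>u \<in> verts G. if u = v then 1 else 0)"
      using k by (intro sum.cong) (auto simp: power_0_left)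
    then have "(\<lambda>u. if u = v then 1 else 0) \<in> S" using v fin(1) by (auto simp: mem_S)
    then show ?thesis by blast
  qed
  moreover have "continuous_on S (adjacency_form k G)"
    unfolding adjacency_form_def
    by (intro continuous_intros continuous_on_subset[OF continuous_on_product_coordinates]) auto
  ultimately obtain z where z: "z \<in> S" "\<And>y. y \<in> S \<Longrightarrow> adjacency_form k G y \<le> adjacency_form k G z"
    using continuous_attains_sup by metis
  show thesis
  proof (rule that[of z])
    show "z u \<ge> 0" for u using z(1) by (cases "u \<in> verts G") (auto simp: mem_S)
    show "(\<Sum>u \<in> verts G. z u ^ k) = 1" using z(1) by (simp add: mem_S)
    fix y :: "'a \<Rightarrow> real" assume y: "\<And>u. u \<in> verts G \<Longrightarrow> y u \<ge> 0"
    define c where "c = (\<Sum>u \<in> verts G. y u ^ k)"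
    have c0: "c \<ge> 0" unfolding c_def by (intro sum_nonneg) (simp add: y)
    show "adjacency_form k G y \<le> adjacency_form k G z * (\<Sum>u \<in> verts G. y u ^ k)"
    proof (cases "c = 0")
      case True
      then have "\<forall>u \<in> verts G. y u ^ k = 0"
        unfolding c_def using y fin(1) by (subst (asm) sum_nonneg_eq_0_iff) auto
      then have "y u = 0 * y u" if "u \<in> verts G" for u using that by auto
      then have "adjacency_form k G y = adjacency_form k G (\<lambda>u. 0 * y u)"
        by (rule adjacency_form_cong[OF G])
      also have "\<dots> = 0" unfolding adjacency_form_scale[OF G] using k by (simp add: power_0_left)
      finally show ?thesis using True by (simp add: c_def)
    next
      case False
      define r where "r = root k c"
      have r: "r > 0" "r ^ k = c" using False c0 k unfolding r_def by auto
      define y' where "y' u = (if u \<in> verts G then inverse r * y u else 0)" for u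
      have sum_y': "(\<Sum>u \<in> verts G. y' u ^ k) = 1"
      proof -
        have "(\<Sum>u \<in> verts G. y' u ^ k) = inverse c * c"
          unfolding c_def sum_distrib_left
          by (intro sum.cong refl) (simp add: y'_def power_mult_distrib power_inverse r(2) flip: c_def)
        then show ?thesis using False by simp
      qed
      have nonneg: "y' u \<ge> 0" for u using y r(1) by (simp add: y'_def)
      have "y' u \<le> 1" if u: "u \<in> verts G" for u
      proof (rule ccontr)
        assume "\<not> y' u \<le> 1"
        then have "1 < y' u ^ k" using k by (intro one_less_power) auto
        also have "\<dots> \<le> (\<Sum>u \<in> verts G. y' u ^ k)"
          using u nonneg fin(1) by (intro member_le_sum) auto
        finally show False using sum_y' by simp
      qed
      then have "y' \<in> S" using nonneg sum_y' unfolding mem_S by (auto simp only: y'_def if_False)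
      then have "adjacency_form k G y' \<le> adjacency_form k G z" by (rule z(2))
      moreover have "adjacency_form k G y' = adjacency_form k G (\<lambda>u. inverse r * y u)"
        by (rule adjacency_form_cong[OF G]) (simp add: y'_def)
      moreover have "\<dots> = inverse c * adjacency_form k G y"
        by (simp add: adjacency_form_scale[OF G] power_inverse r(2))
      ultimately show ?thesis using False c0 by (simp add: c_def field_simps)
    qed
  qed
qed

text \<open>The one-variable optimality condition. At an interior point \<open>a > 0\<close> it is the vanishing of a
  derivative. At the boundary point \<open>a = 0\<close> only one-sided variations are possible; there the
  power \<open>t ^ k\<close> is of higher order than \<open>t\<close> and forces \<open>s \<le> 0\<close>.\<close>

lemma power_tangent_coefficient:
  fixes a s M :: real
  assumes k: "k \<ge> 2" and a: "a \<ge> 0" and s: "s \<ge> 0"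
    and le: "\<And>t. t \<ge> 0 \<Longrightarrow> real k * ((t - a) * s) \<le> M * (t ^ k - a ^ k)"
  shows "M * a ^ (k - 1) = s"
proof (cases "a = 0")
  case True
  have "real k * s \<le> M * t ^ (k - 1)" if t: "t > 0" for t
  proof -
    have "t ^ k = t * t ^ (k - 1)" using k by (simp add: power_eq_if)
    then have "t * (real k * s) \<le> t * (M * t ^ (k - 1))"
      using le[of t] t True k by (simp add: mult_ac power_0_left)
    then show ?thesis using t by simp
  qed
  then have ev: "\<forall>\<^sub>F t in at_right 0. real k * s \<le> M * t ^ (k - 1)"
    by (auto simp: eventually_at_right_field intro: exI[of _ 1])
  have "((\<lambda>t. M * t ^ (k - 1)) \<longlongrightarrow> M * 0 ^ (k - 1)) (at_right 0)"
    by (intro tendsto_intros)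
  then have "real k * s \<le> M * 0 ^ (k - 1)"
    by (rule tendsto_lowerbound[OF _ ev]) simp
  then have "real k * s \<le> 0" using k by (simp add: power_0_left)
  then have "s = 0" using k s by (simp add: mult_le_0_iff)
  then show ?thesis using True k by (simp add: power_0_left)
next
  case False
  let ?h = "\<lambda>t. M * (t ^ k - a ^ k) - real k * ((t - a) * s)"
  have "DERIV ?h a :> M * (real k * a ^ (k - 1)) - real k * s"
    by (auto intro!: derivative_eq_intros)
  moreover have "\<forall>t. \<bar>a - t\<bar> < a \<longrightarrow> ?h a \<le> ?h t" using le by auto
  ultimately have "M * (real k * a ^ (k - 1)) - real k * s = 0"
    using False a by (intro DERIV_local_min[where d = a]) auto
  then have "real k * (M * a ^ (k - 1)) = real k * s" by (simp add: algebra_simps)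
  then show ?thesis using k by simp
qed

lemma maximiser_is_eigenvector:
  assumes G: "uniform_hypergraph k G" and k: "k \<ge> 2"
    and z0: "\<And>u. z u \<ge> 0" and z1: "(\<Sum>u \<in> verts G. z u ^ k) = 1"
    and max: "\<And>y. (\<And>u. u \<in> verts G \<Longrightarrow> y u \<ge> 0) \<Longrightarrow>
       adjacency_form k G y \<le> adjacency_form k G z * (\<Sum>u \<in> verts G. y u ^ k)"
  shows "eigenvector_of k G z (adjacency_form k G z)"
  unfolding eigenvector_of_def
proof (intro conjI ballI)
  note fin = uniform_hypergraph_finite[OF G]
  show "\<exists>u \<in> verts G. z u \<noteq> 0"
  proof (rule ccontr)
    assume "\<not> (\<exists>u \<in> verts G. z u \<noteq> 0)"
    then have "(\<Sum>u \<in> verts G. z u ^ k) = 0" using k by (intro sum.neutral) (auto simp: power_0_left)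
    then show False using z1 by simp
  qed
  fix u assume u: "u \<in> verts G"
  let ?s = "\<Sum>e | e \<in> edges G \<and> u \<in> e. \<Prod>w \<in> e - {u}. z w"
  let ?M = "adjacency_form k G z"
  show "?M * z u ^ (k - 1) = ?s"
  proof (rule power_tangent_coefficient[OF k z0])
    show "?s \<ge> 0" by (intro sum_nonneg prod_nonneg) (auto simp: z0)
    fix t :: real assume t: "t \<ge> 0"
    have "(\<Sum>v \<in> verts G - {u}. (z(u := t)) v ^ k) = (\<Sum>v \<in> verts G - {u}. z v ^ k)"
      by (rule sum.cong) auto
    then have norm: "(\<Sum>v \<in> verts G. (z(u := t)) v ^ k) = 1 + (t ^ k - z u ^ k)"
      using sum.remove[OF fin(1) u, of "\<lambda>v. (z(u := t)) v ^ k"]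
        sum.remove[OF fin(1) u, of "\<lambda>v. z v ^ k"] z1 by simp
    have "adjacency_form k G (z(u := t)) \<le> ?M * (\<Sum>v \<in> verts G. (z(u := t)) v ^ k)"
      by (rule max) (simp add: z0 t)
    then show "real k * ((t - z u) * ?s) \<le> ?M * (t ^ k - z u ^ k)"
      unfolding norm adjacency_form_affine_in_coordinate[OF G] by (simp add: algebra_simps)
  qed
qed

lemma eigenvector_of_real_imp_complex:
  fixes x :: "'v \<Rightarrow> real"
  assumes "eigenvector_of k G x l"
  shows "eigenvector_of k G (\<lambda>u. complex_of_real (x u)) (complex_of_real l)"
  using assms unfolding eigenvector_of_def
  by (simp flip: of_real_power of_real_mult of_real_prod of_real_sum)

text \<open>All moduli of eigenvalues are at most the maximum of the form, and the maximum is itself an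
  eigenvalue; hence the two agree.\<close>

lemma adjacency_form_le_spectral_radius:
  assumes G: "uniform_hypergraph k G" and k: "k \<ge> 2" and ne: "verts G \<noteq> {}"
    and y: "\<And>u. u \<in> verts G \<Longrightarrow> y u \<ge> 0"
  shows "adjacency_form k G y \<le> spectral_radius_of k G * (\<Sum>u \<in> verts G. y u ^ k)"
proof -
  note fin = uniform_hypergraph_finite[OF G]
  have k1: "k \<ge> 1" using k by simp
  obtain z where z: "\<And>u. z u \<ge> 0" "(\<Sum>u \<in> verts G. z u ^ k) = 1"
    and max: "\<And>y. (\<And>u. u \<in> verts G \<Longrightarrow> y u \<ge> 0) \<Longrightarrow>
       adjacency_form k G y \<le> adjacency_form k G z * (\<Sum>u \<in> verts G. y u ^ k)"
    using adjacency_form_maximiser_exists[OF G k1 ne] by metis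
  let ?M = "adjacency_form k G z"
  have M0: "?M \<ge> 0" unfolding adjacency_form_def
    by (intro mult_nonneg_nonneg sum_nonneg prod_nonneg) (auto simp: z)
  have "spectral_radius_of k G = ?M"
    unfolding spectral_radius_of_def
  proof (rule cSup_eq_maximum)
    have "eigenvector_of k G (\<lambda>u. complex_of_real (z u)) (complex_of_real ?M)"
      using maximiser_is_eigenvector[OF G k z max] by (rule eigenvector_of_real_imp_complex)
    moreover have "?M = cmod (complex_of_real ?M)" using M0 by simp
    ultimately show "?M \<in> {cmod l | l. \<exists>x :: 'a \<Rightarrow> complex. eigenvector_of k G x l}" by blast
    fix m assume "m \<in> {cmod l | l. \<exists>x :: 'a \<Rightarrow> complex. eigenvector_of k G x l}"
    then obtain l and x :: "'a \<Rightarrow> complex" where m: "m = cmod l" and x: "eigenvector_of k G x l"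
      by blast
    let ?N = "\<Sum>u \<in> verts G. cmod (x u) ^ k"
    have "cmod l * ?N \<le> ?M * ?N"
      using eigenvalue_le_adjacency_form[OF G k1 x] max[of "\<lambda>u. cmod (x u)"] by simp
    moreover have "?N > 0"
    proof -
      obtain v where v: "v \<in> verts G" "x v \<noteq> 0" using x by (auto simp: eigenvector_of_def)
      show ?thesis by (rule sum_pos2[OF fin(1) v(1)]) (use v in auto)
    qed
    ultimately show "m \<le> ?M" using m by simp
  qed
  then show "adjacency_form k G y \<le> spectral_radius_of k G * (\<Sum>u \<in> verts G. y u ^ k)"
    using max[of y] y by simp
qed

section \<open>Deleting edges\<close>

theorem theorem4p7:
  fixes n k :: nat and G :: "nat hypergraph" and E :: "nat set set"
    and x y :: "nat \<Rightarrow> real"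
  assumes "n \<ge> 2" and "k \<ge> 2"
    and "uniform_hypergraph k G" and "verts G = {1..n}"
    and "E \<subseteq> edges G"
    and "eigenvector_of k G x (spectral_radius_of k G)" and "unit_on k {1..n} x"
    and "odd k \<Longrightarrow> \<forall>u \<in> {1..n}. x u \<ge> 0"
    and "eigenvector_of k (delete_edges G E) y (spectral_radius_of k (delete_edges G E))"
    and "unit_on k {1..n} y"
  shows "spectral_radius_of k G - real k * (\<Sum>e\<in>E. \<Prod>w\<in>e. x w)
           \<le> spectral_radius_of k (delete_edges G E) \<and>
         spectral_radius_of k (delete_edges G E)
           \<le> spectral_radius_of k G - real k * (\<Sum>e\<in>E. \<Prod>w\<in>e. y w)"
proof
  let ?H = "delete_edges G E"
  let ?abs = "\<lambda>x u. \<bar>x u :: real\<bar>"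
  note G = assms(3) and del = adjacency_form_delete_edges[OF assms(3) assms(5)]
  have H: "uniform_hypergraph k ?H" using G by (rule uniform_hypergraph_delete_edges)
  have VH: "verts ?H = {1..n}" by (simp add: delete_edges_def assms(4))
  have neG: "verts G \<noteq> {}" and neH: "verts ?H \<noteq> {}" using assms(1) VH assms(4) by auto
  have unit: "(\<Sum>u \<in> verts G. ?abs x u ^ k) = 1" "(\<Sum>u \<in> verts ?H. ?abs x u ^ k) = 1"
    "(\<Sum>u \<in> verts G. ?abs y u ^ k) = 1" "(\<Sum>u \<in> verts ?H. ?abs y u ^ k) = 1"
    using assms(7,10) unfolding unit_on_def VH assms(4) by auto

  have "spectral_radius_of k G = (\<Sum>u \<in> verts G. spectral_radius_of k G * ?abs x u ^ k)"
    using unit(1) by (simp flip: sum_distrib_left)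
  also have "\<dots> = (\<Sum>u \<in> verts G. x u * (\<Sum>e | e \<in> edges G \<and> u \<in> e. \<Prod>w \<in> e - {u}. x w))"
  proof (intro sum.cong refl)
    fix u assume u: "u \<in> verts G"
    \<comment> \<open>For even \<open>k\<close> the modulus disappears in the power, for odd \<open>k\<close> because \<open>x\<close> is nonnegative.\<close>
    have "?abs x u ^ k = x u ^ k"
      using assms(8) u assms(4) by (cases "even k") (auto simp: power_even_abs)
    also have "\<dots> = x u * x u ^ (k - 1)" using assms(2) by (simp add: power_eq_if)
    finally have "spectral_radius_of k G * ?abs x u ^ k = x u * (spectral_radius_of k G * x u ^ (k - 1))"
      by (simp only: mult.left_commute)
    also have "spectral_radius_of k G * x u ^ (k - 1) =
        (\<Sum>e | e \<in> edges G \<and> u \<in> e. \<Prod>w \<in> e - {u}. x w)"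
      using assms(6) u unfolding eigenvector_of_def by blast
    finally show "spectral_radius_of k G * ?abs x u ^ k =
        x u * (\<Sum>e | e \<in> edges G \<and> u \<in> e. \<Prod>w \<in> e - {u}. x w)" .
  qed
  also have "\<dots> = adjacency_form k G x" by (rule adjacency_form_handshake[OF G])
  finally have "spectral_radius_of k G - real k * (\<Sum>e\<in>E. \<Prod>w\<in>e. x w) = adjacency_form k ?H x"
    by (simp add: del)
  also have "\<dots> \<le> adjacency_form k ?H (?abs x)" by (rule adjacency_form_le_abs)
  also have "\<dots> \<le> spectral_radius_of k ?H"
    using adjacency_form_le_spectral_radius[OF H assms(2) neH, of "?abs x"] unit(2) by simp
  finally show "spectral_radius_of k G - real k * (\<Sum>e\<in>E. \<Prod>w\<in>e. x w) \<le> spectral_radius_of k ?H" .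

  \<comment> \<open>Passing to \<open>|y|\<close> before the deleted edges are put back keeps the trial vector nonnegative.\<close>
  have "spectral_radius_of k ?H \<le> norm (spectral_radius_of k ?H)" by simp
  also have "\<dots> \<le> adjacency_form k ?H (?abs y)"
    using eigenvalue_le_adjacency_form[OF H _ assms(9)] assms(2) unit(4) by simp
  also have "\<dots> = adjacency_form k G (?abs y) - real k * (\<Sum>e\<in>E. \<Prod>w\<in>e. ?abs y w)" by (rule del)
  also have "\<dots> \<le> spectral_radius_of k G - real k * (\<Sum>e\<in>E. \<Prod>w\<in>e. y w)"
  proof (rule diff_mono)
    show "adjacency_form k G (?abs y) \<le> spectral_radius_of k G"
      using adjacency_form_le_spectral_radius[OF G assms(2) neG, of "?abs y"] unit(3) by simp
    show "real k * (\<Sum>e\<in>E. \<Prod>w\<in>e. y w) \<le> real k * (\<Sum>e\<in>E. \<Prod>w\<in>e. ?abs y w)"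
      by (intro mult_left_mono sum_mono) (auto simp flip: abs_prod)
  qed
  finally show "spectral_radius_of k ?H \<le> spectral_radius_of k G - real k * (\<Sum>e\<in>E. \<Prod>w\<in>e. y w)" .
qed

end
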